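(* Let $(S,s)$ be a finite bijective set-theoretic solution to the Pentagon Equation and write $s(x,y)=(x\cdot y,\theta_x(y))$. Then the semigroup $(S,\cdot)$ is a left group.
   Context: A set-theoretic solution to the Pentagon Equation is a pair $(S,s)$ with $S$ a nonempty set and $s:S\times S\to S\times S$ a map such that $s_{23}s_{13}s_{12}=s_{12}s_{23}$ on $S\times S\times S$, where $s_{12}=s\times\mathrm{id}$, $s_{23}=\mathrm{id}\times s$, $s_{13}=(\tau\times\mathrm{id})(\mathrm{id}\times s)(\tau\times\mathrm{id})$ and $\tau(x,y)=(y,x)$. It is finite if $S$ is finite, and bijective if $s$ is bijective. Writing $s(x,y)=(x\cdot y,\theta_x(y))$, the operation $\cdot$ is associative, so $(S,\cdot)$ is a semigroup. A semigroup is a left group if it is isomorphic to $E\times G$, where $E$ is a (nonempty) set, $G$ is a group, and the multiplication is $(e,g)(f,h)=(e,gh)$ for all $e,f\in E$, $g,h\in G$. *)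

theory Defs
  imports "HOL-Algebra.Group"
begin

text \<open>Triples are right-nested, so \<open>id \<times> f\<close> is \<open>map_prod id f\<close>, whereas \<open>f \<times> id\<close> needs re-bracketing.\<close>

definition on12 :: "('a \<times> 'a \<Rightarrow> 'a \<times> 'a) \<Rightarrow> 'a \<times> 'a \<times> 'a \<Rightarrow> 'a \<times> 'a \<times> 'a" where
  "on12 f = (\<lambda>(x, y, z). case f (x, y) of (a, b) \<Rightarrow> (a, b, z))"

definition on23 :: "('a \<times> 'a \<Rightarrow> 'a \<times> 'a) \<Rightarrow> 'a \<times> 'a \<times> 'a \<Rightarrow> 'a \<times> 'a \<times> 'a" where
  "on23 f = map_prod id f"

definition on13 :: "('a \<times> 'a \<Rightarrow> 'a \<times> 'a) \<Rightarrow> 'a \<times> 'a \<times> 'a \<Rightarrow> 'a \<times> 'a \<times> 'a" where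
  "on13 f = on12 prod.swap \<circ> on23 f \<circ> on12 prod.swap"

definition pentagon_solution :: "'a set \<Rightarrow> ('a \<times> 'a \<Rightarrow> 'a \<times> 'a) \<Rightarrow> bool" where
  "pentagon_solution S s \<longleftrightarrow>
     S \<noteq> {} \<and> s \<in> S \<times> S \<rightarrow> S \<times> S \<and>
     (\<forall>t \<in> S \<times> S \<times> S. (on23 s \<circ> on13 s \<circ> on12 s) t = (on12 s \<circ> on23 s) t)"

definition finite_solution :: "'a set \<Rightarrow> ('a \<times> 'a \<Rightarrow> 'a \<times> 'a) \<Rightarrow> bool" where
  "finite_solution S s \<longleftrightarrow> pentagon_solution S s \<and> finite S"

definition bijective_solution :: "'a set \<Rightarrow> ('a \<times> 'a \<Rightarrow> 'a \<times> 'a) \<Rightarrow> bool" where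
  "bijective_solution S s \<longleftrightarrow> pentagon_solution S s \<and> bij_betw s (S \<times> S) (S \<times> S)"

definition semigroup_on :: "'a set \<Rightarrow> ('a \<Rightarrow> 'a \<Rightarrow> 'a) \<Rightarrow> bool" where
  "semigroup_on S m \<longleftrightarrow>
     (\<forall>x\<in>S. \<forall>y\<in>S. m x y \<in> S) \<and>
     (\<forall>x\<in>S. \<forall>y\<in>S. \<forall>z\<in>S. m (m x y) z = m x (m y z))"

definition semigroup_iso ::
  "'a set \<Rightarrow> ('a \<Rightarrow> 'a \<Rightarrow> 'a) \<Rightarrow> 'b set \<Rightarrow> ('b \<Rightarrow> 'b \<Rightarrow> 'b) \<Rightarrow> ('a \<Rightarrow> 'b) \<Rightarrow> bool" where
  "semigroup_iso S m T n \<phi> \<longleftrightarrow>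
     bij_betw \<phi> S T \<and> (\<forall>x\<in>S. \<forall>y\<in>S. \<phi> (m x y) = n (\<phi> x) (\<phi> y))"

definition left_group_mult :: "('g, 'm) monoid_scheme \<Rightarrow> 'e \<times> 'g \<Rightarrow> 'e \<times> 'g \<Rightarrow> 'e \<times> 'g" where
  "left_group_mult G = (\<lambda>(e, g) (f, h). (e, g \<otimes>\<^bsub>G\<^esub> h))"

text \<open>HOL cannot quantify over the types of \<open>E\<close> and \<open>G\<close> here. Taking both over the type of \<open>S\<close>
  loses nothing, since \<open>E\<close> and \<open>G\<close> embed into \<open>E \<times> G\<close>: see \<open>left_groupI\<close> below.\<close>

definition left_group :: "'a set \<Rightarrow> ('a \<Rightarrow> 'a \<Rightarrow> 'a) \<Rightarrow> bool" where
  "left_group S m \<longleftrightarrow> semigroup_on S m \<and>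
     (\<exists>(E :: 'a set) (G :: 'a monoid) \<phi>.
        E \<noteq> {} \<and> group G \<and> semigroup_iso S m (E \<times> carrier G) (left_group_mult G) \<phi>)"

lemma left_groupI:
  fixes S :: "'a set" and E :: "'e set" and G :: "('g, 'm) monoid_scheme"
  assumes sg: "semigroup_on S m" and E: "E \<noteq> {}" and G: "group G"
    and iso: "semigroup_iso S m (E \<times> carrier G) (left_group_mult G) \<phi>"
  shows "left_group S m"
proof -
  interpret G: group G by (rule G)
  obtain e0 where e0: "e0 \<in> E" using E by blast
  define \<psi> where "\<psi> = inv_into S \<phi>"
  have bij: "bij_betw \<phi> S (E \<times> carrier G)"
    and hom: "\<And>x y. x \<in> S \<Longrightarrow> y \<in> S \<Longrightarrow> \<phi> (m x y) = left_group_mult G (\<phi> x) (\<phi> y)"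
    using iso by (auto simp: semigroup_iso_def)
  have inj\<psi>: "inj_on \<psi> (E \<times> carrier G)"
    using bij by (simp add: \<psi>_def bij_betw_def inj_on_inv_into)
  define i where "i e = \<psi> (e, \<one>\<^bsub>G\<^esub>)" for e
  define j where "j g = \<psi> (e0, g)" for g
  have inji: "inj_on i E"
    by (rule inj_onI) (use inj_onD[OF inj\<psi>] in \<open>force simp: i_def\<close>)
  have injj: "inj_on j (carrier G)"
    by (rule inj_onI) (use inj_onD[OF inj\<psi>] e0 in \<open>force simp: j_def\<close>)
  define k where "k = inv_into (carrier G) j"
  have kj: "k (j g) = g" if "g \<in> carrier G" for g
    using injj that by (simp add: k_def)
  define H :: "'a monoid" where
    "H = \<lparr>carrier = j ` carrier G, mult = (\<lambda>x y. j (k x \<otimes>\<^bsub>G\<^esub> k y)), one = j \<one>\<^bsub>G\<^esub>\<rparr>"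
  have H: "group H"
  proof (rule groupI)
    fix x assume "x \<in> carrier H"
    then obtain g where g: "g \<in> carrier G" "x = j g" by (auto simp: H_def)
    show "\<exists>y\<in>carrier H. y \<otimes>\<^bsub>H\<^esub> x = \<one>\<^bsub>H\<^esub>"
      by (rule bexI[of _ "j (inv\<^bsub>G\<^esub> g)"]) (use g in \<open>auto simp: H_def kj\<close>)
  qed (auto simp: H_def kj G.m_assoc)
  have "bij_betw (map_prod i j) (E \<times> carrier G) (i ` E \<times> carrier H)"
    using inji injj unfolding bij_betw_def H_def
    by (auto simp: map_prod_surj_on intro!: map_prod_inj_on)
  then have "bij_betw (map_prod i j \<circ> \<phi>) S (i ` E \<times> carrier H)"
    using bij by (rule bij_betw_trans[rotated])
  moreover have "(map_prod i j \<circ> \<phi>) (m x y)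
      = left_group_mult H ((map_prod i j \<circ> \<phi>) x) ((map_prod i j \<circ> \<phi>) y)"
    if "x \<in> S" "y \<in> S" for x y
  proof -
    have "\<phi> x \<in> E \<times> carrier G" "\<phi> y \<in> E \<times> carrier G"
      using bij that by (auto simp: bij_betw_def)
    then show ?thesis
      by (auto simp: hom that left_group_mult_def H_def kj)
  qed
  ultimately have "semigroup_iso S m (i ` E \<times> carrier H) (left_group_mult H) (map_prod i j \<circ> \<phi>)"
    by (simp add: semigroup_iso_def)
  moreover have "i ` E \<noteq> {}" using E by simp
  ultimately show ?thesis
    using sg H unfolding left_group_def
    by (intro conjI exI[of _ "i ` E"] exI[of _ H] exI[of _ "map_prod i j \<circ> \<phi>"])
qed

end

theory Submission
  imports Defs
begin

text \<open>
  Write \<open>n = |S|\<close>. If \<open>A\<close> is a left ideal, then \<open>s\<close> maps \<open>S \<times> A\<close> injectively into \<open>A \<times> S\<close>;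
  both have \<open>n |A|\<close> elements, so by bijectivity \<open>x \<cdot> y \<in> A\<close> forces \<open>y \<in> A\<close>. Taking for \<open>A\<close> the left
  ideal generated by \<open>x \<cdot> y\<close> yields \<open>y \<in> S \<cdot> x \<cdot> y\<close>, and dually \<open>x \<in> x \<cdot> y \<cdot> S\<close>.
  Now fix \<open>u\<close> and choose \<open>e\<close> with \<open>u \<cdot> e = u\<close>. Whenever \<open>x \<cdot> y = u\<close> we have \<open>y \<in> S \<cdot> u\<close>, so
  \<open>y \<cdot> e = y\<close>, and the pentagon identity
  \<open>\<theta>\<^sub>x(y \<cdot> e) = \<theta>\<^sub>x(y) \<cdot> \<theta>\<^bsub>x \<cdot> y\<^esub>(e)\<close> gives \<open>\<theta>\<^sub>x(y) \<in> S \<cdot> \<theta>\<^sub>u(e)\<close>. As \<open>s\<close> is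
  surjective, \<open>\<theta>\<^sub>x(y)\<close> takes all values under the constraint \<open>x \<cdot> y = u\<close>, so \<open>S = S \<cdot> \<theta>\<^sub>u(e)\<close>. Hence
  \<open>S\<close> is left simple, and a finite left simple semigroup is a left group.
\<close>

text \<open>Left simplicity makes every right translation surjective, hence injective by finiteness.
  Right cancellation turns idempotents into right identities; they form the factor \<open>E\<close>,
  and the group is \<open>e S\<close> for one idempotent \<open>e\<close>.\<close>

lemma left_group_if_finite_left_simple:
  fixes m :: "'a \<Rightarrow> 'a \<Rightarrow> 'a"
  assumes sg: "semigroup_on S m" and fin: "finite S" and ne: "S \<noteq> {}"
    and left_simple: "\<And>a b. a \<in> S \<Longrightarrow> b \<in> S \<Longrightarrow> \<exists>t\<in>S. m t a = b"
  shows "left_group S m"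
proof -
  have closed [simp]: "m x y \<in> S" if "x \<in> S" "y \<in> S" for x y
    using sg that by (auto simp: semigroup_on_def)
  have assoc: "m (m x y) z = m x (m y z)" if "x \<in> S" "y \<in> S" "z \<in> S" for x y z
    using sg that by (auto simp: semigroup_on_def)
  have cancel: "x = y" if "m x a = m y a" "x \<in> S" "y \<in> S" "a \<in> S" for x y a
  proof -
    have "(\<lambda>x. m x a) ` S = S"
      using left_simple[OF \<open>a \<in> S\<close>] \<open>a \<in> S\<close> by force
    then have "inj_on (\<lambda>x. m x a) S"
      using fin by (simp add: eq_card_imp_inj_on)
    then show ?thesis using that by (auto dest: inj_onD)
  qed
  have right_id: "m x f = x" if "f \<in> S" "m f f = f" "x \<in> S" for f x
    using cancel[of "m x f" f x] that by (simp add: assoc)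
  have idem: "m f f = f" if "f \<in> S" "x \<in> S" "m f x = x" for f x
    using cancel[of "m f f" x f] that by (simp add: assoc)
  obtain e where e [simp]: "e \<in> S" "m e e = e"
    using ne left_simple idem by (metis equals0I)
  have right_e [simp]: "m x e = x" if "x \<in> S" for x
    using right_id that by simp
  define E where "E = {f \<in> S. m f f = f}"
  define G :: "'a monoid" where "G = \<lparr>carrier = m e ` S, mult = m, one = e\<rparr>"
  have "e \<in> m e ` S" by (rule image_eqI[of _ _ e]) simp_all
  have G: "group G"
  proof (rule groupI)
    fix g assume "g \<in> carrier G"
    then have g: "g \<in> S" by (auto simp: G_def)
    then obtain t where "t \<in> S" "m t g = e"
      using left_simple[of g e] by auto
    then have "m e t \<in> m e ` S" "m (m e t) g = e"
      using g by (simp_all add: assoc)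
    then show "\<exists>h\<in>carrier G. h \<otimes>\<^bsub>G\<^esub> g = \<one>\<^bsub>G\<^esub>"
      unfolding G_def by auto
  qed (use \<open>e \<in> m e ` S\<close> in \<open>auto simp: G_def assoc simp flip: assoc[of e e]\<close>)
  \<comment> \<open>By cancellation \<open>x\<close> has exactly one left identity. As
    \<open>e\<close> is a right identity, \<open>x\<close> is the product of \<open>p x\<close> and
    \<open>m e x\<close>, so this pair determines \<open>x\<close>.\<close>
  define p where "p x = (THE f. f \<in> S \<and> m f x = x)" for x
  have p_eq: "p x = f" if "f \<in> S" "x \<in> S" "m f x = x" for f x
    unfolding p_def using that by (intro the_equality) (auto intro: cancel[of _ x])
  have p: "p x \<in> S" "m (p x) x = x" "m (p x) (p x) = p x" if x: "x \<in> S" for x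
  proof -
    obtain f where "f \<in> S" "m f x = x" using left_simple[OF x x] by auto
    then show "p x \<in> S" "m (p x) x = x" "m (p x) (p x) = p x"
      using p_eq idem x by auto
  qed
  define \<phi> where "\<phi> x = (p x, m e x)" for x
  have "inj_on \<phi> S"
  proof (rule inj_onI)
    fix x y assume xy: "x \<in> S" "y \<in> S" and "\<phi> x = \<phi> y"
    then have eq: "p x = p y" "m e x = m e y" by (auto simp: \<phi>_def)
    have "m (p z) (m e z) = z" if "z \<in> S" for z
      using p[OF that] that by (simp flip: assoc)
    then show "x = y" using eq xy by metis
  qed
  moreover have "\<phi> ` S = E \<times> carrier G"
  proof (intro equalityI subsetI)
    fix z assume "z \<in> \<phi> ` S"
    then show "z \<in> E \<times> carrier G" using p by (auto simp: \<phi>_def E_def G_def)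
  next
    fix z assume "z \<in> E \<times> carrier G"
    then obtain f x where z: "z = (f, m e x)" and f: "f \<in> S" "m f f = f" and x: "x \<in> S"
      by (auto simp: E_def G_def)
    \<comment> \<open>The preimage of \<open>(f, m e x)\<close> is \<open>m f x\<close>: here
      \<open>m e f = e\<close>, since the idempotent \<open>f\<close> is a right identity.\<close>
    have fx: "m f x \<in> S" using f x by simp
    have "p (m f x) = f" using f x by (intro p_eq) (auto simp flip: assoc)
    moreover have "m e (m f x) = m e x"
      using f x right_id[of f e] by (simp flip: assoc)
    ultimately have "\<phi> (m f x) = z" by (simp add: \<phi>_def z)
    then show "z \<in> \<phi> ` S" using fx by blast
  qed
  ultimately have "bij_betw \<phi> S (E \<times> carrier G)" by (simp add: bij_betw_def)
  moreover have "\<phi> (m x y) = left_group_mult G (\<phi> x) (\<phi> y)" if "x \<in> S" "y \<in> S" for x y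
  proof -
    have "p (m x y) = p x" using that p by (intro p_eq) (auto simp flip: assoc)
    moreover have "m (m e x) (m e y) = m e (m x y)"
    proof -
      have "m x (m e y) = m x y" using that by (simp flip: assoc)
      then show ?thesis using that by (simp add: assoc)
    qed
    ultimately show ?thesis by (simp add: \<phi>_def left_group_mult_def G_def)
  qed
  ultimately have "semigroup_iso S m (E \<times> carrier G) (left_group_mult G) \<phi>"
    by (simp add: semigroup_iso_def)
  moreover have "E \<noteq> {}" using e unfolding E_def by blast
  ultimately show ?thesis by (intro left_groupI[OF sg _ G])
qed

text \<open>At \<open>(x, y, z)\<close>, the first components of the pentagon equation give
  associativity and the second components the identity for \<theta>.\<close>

lemma pentagon_equations:
  assumes pent: "pentagon_solution S s"
    and s: "\<And>x y. x \<in> S \<Longrightarrow> y \<in> S \<Longrightarrow> s (x, y) = (dot x y, \<theta> x y)"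
  shows "semigroup_on S dot"
    and "x \<in> S \<Longrightarrow> y \<in> S \<Longrightarrow> \<theta> x y \<in> S"
    and "x \<in> S \<Longrightarrow> y \<in> S \<Longrightarrow> z \<in> S \<Longrightarrow> \<theta> x (dot y z) = dot (\<theta> x y) (\<theta> (dot x y) z)"
proof -
  have cl: "dot x y \<in> S" "\<theta> x y \<in> S" if "x \<in> S" "y \<in> S" for x y
  proof -
    have "s (x, y) \<in> S \<times> S" using pent that by (auto simp: pentagon_solution_def)
    then show "dot x y \<in> S" "\<theta> x y \<in> S" using s that by auto
  qed
  have "dot (dot x y) z = dot x (dot y z) \<and>
      \<theta> x (dot y z) = dot (\<theta> x y) (\<theta> (dot x y) z)" if "x \<in> S" "y \<in> S" "z \<in> S" for x y z
  proof -
    have "(on23 s \<circ> on13 s \<circ> on12 s) (x, y, z) = (on12 s \<circ> on23 s) (x, y, z)"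
      using pent that unfolding pentagon_solution_def by blast
    then show ?thesis using that by (simp add: on12_def on23_def on13_def s cl)
  qed
  then show "semigroup_on S dot"
    and "x \<in> S \<Longrightarrow> y \<in> S \<Longrightarrow> z \<in> S \<Longrightarrow> \<theta> x (dot y z) = dot (\<theta> x y) (\<theta> (dot x y) z)"
    using cl by (auto simp: semigroup_on_def)
  show "x \<in> S \<Longrightarrow> y \<in> S \<Longrightarrow> \<theta> x y \<in> S" using cl by blast
qed

text \<open>Pigeonhole: equal cardinalities make \<open>f\<close> map \<open>A\<close> onto
  \<open>B\<close>, so by injectivity no point outside \<open>A\<close> can have its image in
  \<open>B\<close>.\<close>

lemma mem_if_image_mem_card_eq:
  assumes "inj_on f X" "finite B" "A \<subseteq> X" "f ` A \<subseteq> B" "card A = card B"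
    and "x \<in> X" "f x \<in> B"
  shows "x \<in> A"
proof -
  have "card (f ` A) = card B"
    using assms by (metis card_image inj_on_subset)
  then have "f ` A = B" using assms by (intro card_subset_eq) auto
  then show ?thesis using assms by (metis inj_on_image_mem_iff)
qed

theorem theorem2p4:
  fixes S :: "'a set" and s :: "'a \<times> 'a \<Rightarrow> 'a \<times> 'a"
    and dot :: "'a \<Rightarrow> 'a \<Rightarrow> 'a" and \<theta> :: "'a \<Rightarrow> 'a \<Rightarrow> 'a"
  assumes "finite_solution S s" and "bijective_solution S s"
    and "\<And>x y. x \<in> S \<Longrightarrow> y \<in> S \<Longrightarrow> s (x, y) = (dot x y, \<theta> x y)"
  shows "left_group S dot"
proof -
  note s = assms(3)
  have pent: "pentagon_solution S s" and fin: "finite S" and ne: "S \<noteq> {}"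
    and bij: "bij_betw s (S \<times> S) (S \<times> S)"
    using assms(1,2) by (auto simp: finite_solution_def bijective_solution_def pentagon_solution_def)
  have sg: "semigroup_on S dot"
    using pent s by (rule pentagon_equations(1))
  have \<theta>_closed [simp]: "\<theta> x y \<in> S" if "x \<in> S" "y \<in> S" for x y
    using pent s that by (rule pentagon_equations(2))
  have \<theta>_dot: "\<theta> x (dot y z) = dot (\<theta> x y) (\<theta> (dot x y) z)"
    if "x \<in> S" "y \<in> S" "z \<in> S" for x y z
    using pent s that by (rule pentagon_equations(3))
  have closed [simp]: "dot x y \<in> S" if "x \<in> S" "y \<in> S" for x y
    using sg that by (auto simp: semigroup_on_def)
  have assoc: "dot (dot x y) z = dot x (dot y z)" if "x \<in> S" "y \<in> S" "z \<in> S" for x y z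
    using sg that by (auto simp: semigroup_on_def)
  have inj: "inj_on s (S \<times> S)" using bij by (simp add: bij_betw_def)

  have left_div: "\<exists>t\<in>S. dot t (dot x y) = y" if xy: "x \<in> S" "y \<in> S" for x y
  proof -
    define A where "A = insert (dot x y) ((\<lambda>t. dot t (dot x y)) ` S)"
    have A: "A \<subseteq> S" using xy by (auto simp: A_def)
    have ideal: "dot z a \<in> A" if "z \<in> S" "a \<in> A" for z a
      using that xy by (auto simp: A_def simp flip: assoc)
    have "(x, y) \<in> S \<times> A"
    proof (rule mem_if_image_mem_card_eq[OF inj])
      show "s ` (S \<times> A) \<subseteq> A \<times> S" using A by (auto simp: s ideal subset_iff)
      show "finite (A \<times> S)" using A fin finite_subset by blast
      show "card (S \<times> A) = card (A \<times> S)" by (simp add: card_cartesian_product)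
      show "s (x, y) \<in> A \<times> S" using xy by (simp add: s A_def)
    qed (use A xy in auto)
    then have "y = dot x y \<or> (\<exists>t\<in>S. dot t (dot x y) = y)"
      unfolding A_def mem_Sigma_iff insert_iff image_iff by metis
    \<comment> \<open>If \<open>y = dot x y\<close>, then \<open>x\<close> itself serves as
      \<open>t\<close>.\<close>
    then show ?thesis using xy by metis
  qed
  have right_div: "\<exists>t\<in>S. dot (dot x y) t = x" if xy: "x \<in> S" "y \<in> S" for x y
  proof -
    \<comment> \<open>For a right ideal \<open>A\<close>, \<open>s\<close> maps
      \<open>A \<times> S\<close> into itself, so the counting needs no exchange of factors.\<close>
    define A where "A = insert (dot x y) ((\<lambda>t. dot (dot x y) t) ` S)"
    have A: "A \<subseteq> S" using xy by (auto simp: A_def)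
    have ideal: "dot a z \<in> A" if "z \<in> S" "a \<in> A" for z a
      using that xy by (auto simp: A_def assoc)
    have "(x, y) \<in> A \<times> S"
    proof (rule mem_if_image_mem_card_eq[OF inj])
      show "s ` (A \<times> S) \<subseteq> A \<times> S" using A by (auto simp: s ideal subset_iff)
      show "finite (A \<times> S)" using A fin finite_subset by blast
      show "s (x, y) \<in> A \<times> S" using xy by (simp add: s A_def)
    qed (use A xy in auto)
    then have "x = dot x y \<or> (\<exists>t\<in>S. dot (dot x y) t = x)"
      unfolding A_def mem_Sigma_iff insert_iff image_iff by metis
    then show ?thesis using xy by metis
  qed

  obtain u where u: "u \<in> S" using ne by blast
  \<comment> \<open>If \<open>dot (dot u u) t = u\<close>, then \<open>e = dot u t\<close>
    works.\<close>
  obtain e where e: "e \<in> S" "dot u e = u"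
    using right_div[OF u u] u by (metis assoc closed)
  define c where "c = \<theta> u e"
  have c: "c \<in> S" using u e by (simp add: c_def)
  have gen: "\<exists>t\<in>S. dot t c = v" if v: "v \<in> S" for v
  proof -
    have "(u, v) \<in> s ` (S \<times> S)" using bij u v by (simp add: bij_betw_def)
    then obtain x y where xy: "x \<in> S" "y \<in> S" "dot x y = u" "\<theta> x y = v"
      using s by auto
    obtain t where "t \<in> S" "dot t u = y" using left_div xy by metis
    then have "dot y e = y" using e u assoc by metis
    \<comment> \<open>Here \<open>v = \<theta> x y = \<theta> x (dot y e)\<close>, so
      \<open>c\<close> acts as a right identity and \<open>v\<close> is its own left factor.\<close>
    then have "v = dot v c" using \<theta>_dot[of x y e] xy e by (simp add: c_def)
    then show ?thesis using v by metis
  qed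
  have "\<exists>t\<in>S. dot t a = b" if a: "a \<in> S" and b: "b \<in> S" for a b
  proof -
    \<comment> \<open>Every element is a left multiple of \<open>c\<close>, and \<open>c\<close> is
      a left multiple of \<open>a\<close> because \<open>left_div\<close> undoes the factor
      \<open>q\<close>.\<close>
    obtain q where q: "q \<in> S" "dot q c = a" using gen a by blast
    obtain r where r: "r \<in> S" "dot r a = c" using left_div[OF q(1) c] q by blast
    obtain t where t: "t \<in> S" "dot t c = b" using gen b by blast
    have "dot (dot t r) a = b" using assoc r t a by simp
    then show ?thesis using r t by (metis closed)
  qed
  then show ?thesis
    by (rule left_group_if_finite_left_simple[OF sg fin ne])
qed

end
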